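(* Let $n\ge 1$ be an integer, let $F:\mathbb{R}\to\mathbb{R}$ be a smooth periodic function, and let $u\in C^2(\mathbb{R}^n)$ be a solution of $$-\Delta u = F'(u)\quad\text{in }\mathbb{R}^n .$$ Assume that there exist a nonzero vector $\alpha\in\mathbb{R}^n$ and a constant $C>0$ such that $$|u(x)-\alpha\cdot x|\le C\quad\text{for all }x\in\mathbb{R}^n .$$ Then there is a function $v$ of one real variable, of class $C^2$, such that $u(x)=v(\alpha\cdot x)$ for all $x\in\mathbb{R}^n$.
   Context: $\alpha\cdot x$ denotes the Euclidean inner product on $\mathbb{R}^n$. *)

theory Defs
  imports "HOL-Analysis.Analysis"
begin

definition has_partial :: "('a::euclidean_space \<Rightarrow> real) \<Rightarrow> 'a \<Rightarrow> 'a \<Rightarrow> bool" where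
  "has_partial f b x \<longleftrightarrow> (\<lambda>t::real. f (x + t *\<^sub>R b)) differentiable (at 0)"

text \<open>The value is meaningful only where \<^term>\<open>has_partial f b x\<close> holds.\<close>

definition partial :: "'a::euclidean_space \<Rightarrow> ('a \<Rightarrow> real) \<Rightarrow> 'a \<Rightarrow> real" where
  "partial b f x = deriv (\<lambda>t::real. f (x + t *\<^sub>R b)) 0"

text \<open>
  All iterated partial derivatives of order at most \<open>k\<close>, mixed ones included, exist and are
  continuous on the whole space.  On \<^typ>\<open>real\<close>, where the only basis vector is \<open>1\<close>, these
  are the ordinary derivatives.
\<close>

primrec Ck :: "nat \<Rightarrow> ('a::euclidean_space \<Rightarrow> real) \<Rightarrow> bool" where
  "Ck 0 f \<longleftrightarrow> continuous_on UNIV f"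
| "Ck (Suc k) f \<longleftrightarrow> continuous_on UNIV f \<and>
     (\<forall>b\<in>Basis. (\<forall>x. has_partial f b x) \<and> Ck k (partial b f))"

definition smooth :: "('a::euclidean_space \<Rightarrow> real) \<Rightarrow> bool" where
  "smooth f \<longleftrightarrow> (\<forall>k. Ck k f)"

definition laplacian :: "('a::euclidean_space \<Rightarrow> real) \<Rightarrow> 'a \<Rightarrow> real" where
  "laplacian f x = (\<Sum>b\<in>Basis. partial b (partial b f) x)"

end

theory Submission
  imports Defs
begin

text \<open>
  The proof is a sliding argument.  It shows that \<open>u (x + h) \<ge> u x\<close> whenever \<open>\<alpha> \<bullet> h > 0\<close>; by
  continuity this extends to \<open>\<alpha> \<bullet> h = 0\<close>, and applying it to both \<open>h\<close> and \<open>- h\<close> makes \<open>u\<close>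
  constant on the hyperplanes orthogonal to \<open>\<alpha>\<close>.  The profile \<open>v\<close> is then read off along a
  coordinate axis that is not orthogonal to \<open>\<alpha>\<close>, so that its derivatives are multiples of pure
  partial derivatives of \<open>u\<close>.

  Fix \<open>h\<close> with \<open>\<alpha> \<bullet> h > 0\<close>.  Since \<open>u\<close> stays within \<open>C\<close> of a linear function, the inequality
  \<open>u x \<le> u (x + s h)\<close> holds for all large \<open>s\<close>.  Let \<open>t\<close> be the infimum of the thresholds beyond which
  it holds, suppose \<open>t > 0\<close>, and put \<open>k = t h\<close> and \<open>w x = u (x + k) - u x\<close>.  Then \<open>w \<ge> 0\<close>, and
  \<open>w\<close> is a supersolution \<open>\<Delta> w \<le> l w\<close>, where \<open>l\<close> is a Lipschitz constant of \<open>F'\<close>.  The key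
  claim is that \<open>w\<close> is bounded below by a positive constant.  Telescoping gives
  \<open>w x + w (x + k) + \<dots> + w (x + (N - 1) k) = u (x + N k) - u x \<ge> N (\<alpha> \<bullet> k) - 2 C\<close>, which
  exceeds \<open>1\<close> for a suitable \<open>N\<close> independent of \<open>x\<close>.  So within a bounded distance of
  every \<open>x\<close> there is a point where \<open>w > 1 / N\<close>.  As \<open>u\<close> is Lipschitz, \<open>w\<close> is bounded below
  on a ball of fixed radius around that point, and the weak Harnack inequality
  (\<open>weak_Harnack\<close>) carries a uniform positive lower bound back to \<open>x\<close>.  By the Lipschitz bound, \<open>t\<close>
  can then be decreased, contradicting its choice.

  The two analytic ingredients are quantitative and both follow from the minimum principle
  with an explicit barrier: a global Lipschitz bound for bounded functions with bounded Laplacian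
  (\<open>bounded_laplacian_imp_Lipschitz\<close>), applied to \<open>u x - \<alpha> \<bullet> x\<close>, and the weak Harnack
  inequality, with a Gaussian barrier on an annulus.  The periodicity of \<open>F\<close>
  enters through the boundedness of \<open>F'\<close> and \<open>F''\<close>.
\<close>

section \<open>Pointwise Laplacians\<close>

definition has_second_along :: "('a::euclidean_space \<Rightarrow> real) \<Rightarrow> 'a \<Rightarrow> real \<Rightarrow> 'a \<Rightarrow> bool" where
  "has_second_along g b d x \<longleftrightarrow>
     (\<exists>g'. (\<forall>t. ((\<lambda>t. g (x + t *\<^sub>R b)) has_field_derivative g' t) (at t)) \<and>
           (g' has_field_derivative d) (at 0))"

text \<open>
  A relational form of the Laplacian, in which the existence of the derivatives is part of
  the statement, so that sums, multiples, translates and reflections combine without separate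
  differentiability conditions.
\<close>

definition has_laplacian :: "('a::euclidean_space \<Rightarrow> real) \<Rightarrow> real \<Rightarrow> 'a \<Rightarrow> bool" where
  "has_laplacian g L x \<longleftrightarrow>
     (\<exists>D. (\<forall>b\<in>Basis. has_second_along g b (D b) x) \<and> L = (\<Sum>b\<in>Basis. D b))"

lemma has_second_along_add:
  assumes "has_second_along f b c x" "has_second_along g b d x"
  shows "has_second_along (\<lambda>x. f x + g x) b (c + d) x"
proof -
  obtain f' g' where
    "\<forall>t. ((\<lambda>t. f (x + t *\<^sub>R b)) has_field_derivative f' t) (at t)" "(f' has_field_derivative c) (at 0)"
    "\<forall>t. ((\<lambda>t. g (x + t *\<^sub>R b)) has_field_derivative g' t) (at t)" "(g' has_field_derivative d) (at 0)"
    using assms unfolding has_second_along_def by blast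
  then show ?thesis
    unfolding has_second_along_def by (intro exI[of _ "\<lambda>t. f' t + g' t"]) (auto intro: DERIV_add)
qed

lemma has_second_along_cmult:
  assumes "has_second_along f b d x"
  shows "has_second_along (\<lambda>x. c * f x) b (c * d) x"
proof -
  obtain f' where
    "\<forall>t. ((\<lambda>t. f (x + t *\<^sub>R b)) has_field_derivative f' t) (at t)" "(f' has_field_derivative d) (at 0)"
    using assms unfolding has_second_along_def by blast
  then show ?thesis
    unfolding has_second_along_def by (intro exI[of _ "\<lambda>t. c * f' t"]) (auto intro: DERIV_cmult)
qed

lemma has_second_along_uminus_direction:
  assumes "has_second_along f b d x"
  shows "has_second_along f (- b) d x"
proof -
  obtain f' where f':
    "\<And>t. ((\<lambda>t. f (x + t *\<^sub>R b)) has_field_derivative f' t) (at t)" "(f' has_field_derivative d) (at 0)"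
    using assms unfolding has_second_along_def by blast
  have "((\<lambda>t. f (x + t *\<^sub>R (- b))) has_field_derivative - f' (- t)) (at t)" for t
    using DERIV_chain'[OF DERIV_minus[OF DERIV_ident] f'(1), of t] by simp
  moreover have "((\<lambda>t. - f' (- t)) has_field_derivative d) (at 0)"
    using DERIV_minus[OF DERIV_chain'[OF DERIV_minus[OF DERIV_ident], of f' d 0]] f'(2) by simp
  ultimately show ?thesis
    unfolding has_second_along_def by (intro exI[of _ "\<lambda>t. - f' (- t)"]) simp
qed

lemma has_laplacian_add:
  assumes "has_laplacian f c x" "has_laplacian g d x"
  shows "has_laplacian (\<lambda>x. f x + g x) (c + d) x"
proof -
  obtain D E where "\<forall>b\<in>Basis. has_second_along f b (D b) x" "c = (\<Sum>b\<in>Basis. D b)"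
    "\<forall>b\<in>Basis. has_second_along g b (E b) x" "d = (\<Sum>b\<in>Basis. E b)"
    using assms unfolding has_laplacian_def by blast
  then show ?thesis
    unfolding has_laplacian_def
    by (intro exI[of _ "\<lambda>b. D b + E b"]) (auto intro: has_second_along_add simp: sum.distrib)
qed

lemma has_laplacian_cmult:
  assumes "has_laplacian f d x"
  shows "has_laplacian (\<lambda>x. c * f x) (c * d) x"
proof -
  obtain D where "\<forall>b\<in>Basis. has_second_along f b (D b) x" "d = (\<Sum>b\<in>Basis. D b)"
    using assms unfolding has_laplacian_def by blast
  then show ?thesis
    unfolding has_laplacian_def
    by (intro exI[of _ "\<lambda>b. c * D b"]) (auto intro: has_second_along_cmult simp: sum_distrib_left)
qed

lemma has_laplacian_diff:
  assumes "has_laplacian f c x" "has_laplacian g d x"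
  shows "has_laplacian (\<lambda>x. f x - g x) (c - d) x"
  using has_laplacian_add[OF assms(1) has_laplacian_cmult[OF assms(2), of "-1"]] by simp

lemma has_laplacian_translate:
  assumes "has_laplacian f d (p + x)"
  shows "has_laplacian (\<lambda>x. f (p + x)) d x"
  using assms unfolding has_laplacian_def has_second_along_def by (simp add: add.assoc)

text \<open>
  A reflection in a coordinate hyperplane permutes the coordinate lines and only reverses one
  of them, so every pure second derivative is preserved.
\<close>

lemma has_laplacian_reflect:
  fixes e :: "'a::euclidean_space"
  assumes "e \<in> Basis" "has_laplacian f d (x - (2 * (x \<bullet> e)) *\<^sub>R e)"
  shows "has_laplacian (\<lambda>x. f (x - (2 * (x \<bullet> e)) *\<^sub>R e)) d x"
proof -
  let ?r = "\<lambda>x. x - (2 * (x \<bullet> e)) *\<^sub>R e"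
  obtain D where D: "\<And>b. b \<in> Basis \<Longrightarrow> has_second_along f b (D b) (?r x)" "d = (\<Sum>b\<in>Basis. D b)"
    using assms(2) unfolding has_laplacian_def by blast
  have "has_second_along (\<lambda>x. f (?r x)) b (D b) x" if b: "b \<in> Basis" for b
  proof -
    have "has_second_along f (?r b) (D b) (?r x)"
    proof (cases "b = e")
      case True
      then have "?r b = - b"
        using b by (simp add: inner_same_Basis scaleR_2)
      then show ?thesis
        using has_second_along_uminus_direction[OF D(1)[OF b]] by simp
    next
      case False
      then show ?thesis
        using b assms(1) D(1)[OF b] by (simp add: inner_not_same_Basis)
    qed
    moreover have "?r (x + t *\<^sub>R b) = ?r x + t *\<^sub>R ?r b" for t
      by (simp add: inner_add_left algebra_simps)
    ultimately show ?thesis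
      unfolding has_second_along_def by presburger
  qed
  then show ?thesis
    using D(2) unfolding has_laplacian_def by blast
qed

lemma has_laplacian_inner_left: "has_laplacian (\<lambda>x. a \<bullet> x) 0 x"
proof -
  have "has_second_along (\<lambda>x. a \<bullet> x) b 0 x" for b
    unfolding has_second_along_def inner_add_right inner_scaleR_right
    by (intro exI[of _ "\<lambda>t. a \<bullet> b"]) (auto intro!: derivative_eq_intros)
  then show ?thesis
    unfolding has_laplacian_def by (intro exI[of _ "\<lambda>_. 0"]) simp
qed

lemma has_laplacian_const: "has_laplacian (\<lambda>_. c) 0 x"
proof -
  have "has_second_along (\<lambda>_. c) b 0 x" for b :: 'a
    unfolding has_second_along_def by (intro exI[of _ "\<lambda>_. 0"]) simp
  then show ?thesis
    unfolding has_laplacian_def by (intro exI[of _ "\<lambda>_. 0"]) simp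
qed

lemma has_laplacian_coordinate_square:
  assumes "e \<in> Basis"
  shows "has_laplacian (\<lambda>x. (e \<bullet> x)\<^sup>2) 2 x"
proof -
  have "has_second_along (\<lambda>x. (e \<bullet> x)\<^sup>2) b (2 * (e \<bullet> b)\<^sup>2) x" for b
    unfolding has_second_along_def inner_add_right inner_scaleR_right
    by (intro exI[of _ "\<lambda>t. 2 * (e \<bullet> x + t * (e \<bullet> b)) * (e \<bullet> b)"])
       (auto intro!: derivative_eq_intros simp: power2_eq_square)
  moreover have "(\<Sum>b\<in>Basis. 2 * (e \<bullet> b)\<^sup>2) = 2"
    using assms euclidean_inner[of e e]
    by (simp add: sum_distrib_left[symmetric] power2_eq_square inner_same_Basis)
  ultimately show ?thesis
    unfolding has_laplacian_def by (intro exI[of _ "\<lambda>b. 2 * (e \<bullet> b)\<^sup>2"]) simp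
qed

lemma norm_square_along_Basis:
  assumes "b \<in> Basis"
  shows "(norm (x + t *\<^sub>R b))\<^sup>2 = (norm x)\<^sup>2 + 2 * t * (x \<bullet> b) + t\<^sup>2"
  unfolding power2_norm_eq_inner inner_add_left inner_add_right inner_scaleR_left
    inner_scaleR_right inner_commute[of b x]
  using assms by (simp add: power2_eq_square distrib_left)

lemma has_laplacian_norm_square:
  fixes x :: "'a::euclidean_space"
  shows "has_laplacian (\<lambda>x. (norm x)\<^sup>2) (2 * DIM('a)) x"
proof -
  have "has_second_along (\<lambda>x. (norm x)\<^sup>2) b 2 x" if "b \<in> Basis" for b
    unfolding has_second_along_def norm_square_along_Basis[OF that]
    by (intro exI[of _ "\<lambda>t. 2 * (x \<bullet> b) + 2 * t"]) (auto intro!: derivative_eq_intros)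
  then show ?thesis
    unfolding has_laplacian_def by (intro exI[of _ "\<lambda>_. 2"]) simp
qed

lemma has_laplacian_gaussian:
  fixes x :: "'a::euclidean_space"
  shows "has_laplacian (\<lambda>x. exp (- a * (norm x)\<^sup>2))
    (exp (- a * (norm x)\<^sup>2) * (4 * a\<^sup>2 * (norm x)\<^sup>2 - 2 * a * DIM('a))) x"
proof -
  let ?E = "exp (- a * (norm x)\<^sup>2)"
  have "has_second_along (\<lambda>x. exp (- a * (norm x)\<^sup>2)) b (?E * (4 * a\<^sup>2 * (x \<bullet> b)\<^sup>2 - 2 * a)) x"
    if "b \<in> Basis" for b
    unfolding has_second_along_def norm_square_along_Basis[OF that]
    by (intro exI[of _ "\<lambda>t. exp (- a * ((norm x)\<^sup>2 + 2 * t * (x \<bullet> b) + t\<^sup>2)) *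
                           (- a * (2 * (x \<bullet> b) + 2 * t))"])
       (auto intro!: derivative_eq_intros simp: power2_eq_square algebra_simps)
  moreover have "(\<Sum>b\<in>Basis. ?E * (4 * a\<^sup>2 * (x \<bullet> b)\<^sup>2 - 2 * a)) =
      ?E * (4 * a\<^sup>2 * (norm x)\<^sup>2 - 2 * a * DIM('a))"
    using euclidean_inner[of x x]
    by (simp add: sum_distrib_left[symmetric] sum_subtractf power2_norm_eq_inner flip: power2_eq_square)
  ultimately show ?thesis
    unfolding has_laplacian_def
    by (intro exI[of _ "\<lambda>b. ?E * (4 * a\<^sup>2 * (x \<bullet> b)\<^sup>2 - 2 * a)"]) simp
qed

section \<open>Continuously differentiable functions and partial derivatives\<close>

lemma has_field_derivative_at_0_shift:
  fixes f :: "real \<Rightarrow> real"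
  assumes "((\<lambda>s. f (t + s)) has_field_derivative d) (at 0)"
  shows "(f has_field_derivative d) (at t)"
  using assms DERIV_shift[of f d 0 t] by (simp add: add.commute)

lemma has_field_derivative_partial:
  assumes "has_partial f b (x + t *\<^sub>R b)"
  shows "((\<lambda>t. f (x + t *\<^sub>R b)) has_field_derivative partial b f (x + t *\<^sub>R b)) (at t)"
proof (rule has_field_derivative_at_0_shift)
  have "(\<lambda>s. f (x + t *\<^sub>R b + s *\<^sub>R b)) = (\<lambda>s. f (x + (t + s) *\<^sub>R b))"
    by (simp add: algebra_simps)
  then show "((\<lambda>s. f (x + (t + s) *\<^sub>R b)) has_field_derivative partial b f (x + t *\<^sub>R b)) (at 0)"
    using assms unfolding has_partial_def partial_def
    by (simp add: DERIV_deriv_iff_real_differentiable)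
qed

lemma Ck_2D:
  assumes "Ck 2 f" "b \<in> Basis"
  shows "continuous_on UNIV f" "has_partial f b x" "continuous_on UNIV (partial b f)"
    "has_partial (partial b f) b x" "continuous_on UNIV (partial b (partial b f))"
  using assms by (auto simp: numeral_2_eq_2)

lemma has_laplacian_laplacian:
  assumes "Ck 2 u"
  shows "has_laplacian u (laplacian u x) x"
proof -
  have "has_second_along u b (partial b (partial b u) x) x" if "b \<in> Basis" for b
    unfolding has_second_along_def
    using has_field_derivative_partial[OF Ck_2D(2)[OF assms that], of x]
      has_field_derivative_partial[OF Ck_2D(4)[OF assms that], of x 0]
    by (intro exI[of _ "\<lambda>t. partial b u (x + t *\<^sub>R b)"]) simp
  then show ?thesis
    unfolding has_laplacian_def laplacian_def
    by (intro exI[of _ "\<lambda>b. partial b (partial b u) x"]) simp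
qed

section \<open>The minimum principle\<close>

text \<open>
  At the minimum \<open>g'\<close> vanishes.  If its derivative were negative there, \<open>g'\<close> would be negative
  just to the right, and \<open>g\<close> would drop below its minimum by the mean value theorem.
\<close>

lemma second_deriv_nonneg_at_min:
  fixes g :: "real \<Rightarrow> real"
  assumes g: "\<And>t. (g has_field_derivative g' t) (at t)" and d: "(g' has_field_derivative d) (at 0)"
    and r: "0 < r" and min: "\<And>t. \<bar>t\<bar> < r \<Longrightarrow> g 0 \<le> g t"
  shows "0 \<le> d"
proof (rule ccontr)
  assume "\<not> 0 \<le> d"
  have 0: "g' 0 = 0"
    using DERIV_local_min[OF g r] min by auto
  obtain s where s: "0 < s" "\<And>h. 0 < h \<Longrightarrow> h < s \<Longrightarrow> g' h < g' 0"
    using DERIV_neg_dec_right[OF d] \<open>\<not> 0 \<le> d\<close> by force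
  define h where "h = min r s / 2"
  have h: "0 < h" "h < r" "h < s"
    using r s(1) by (auto simp: h_def)
  obtain z where "0 < z" "z < h" "g h - g 0 = (h - 0) * g' z"
    using MVT2[OF h(1), of g g'] g by blast
  then have "g h < g 0"
    using s(2)[of z] h 0 mult_pos_neg[of h "g' z"] by auto
  then show False
    using min[of h] h by auto
qed

lemma has_laplacian_nonneg_at_min:
  assumes "has_laplacian f L x" "open U" "x \<in> U" "\<And>y. y \<in> U \<Longrightarrow> f x \<le> f y"
  shows "0 \<le> L"
proof -
  obtain D where D: "\<And>b. b \<in> Basis \<Longrightarrow> has_second_along f b (D b) x" "L = (\<Sum>b\<in>Basis. D b)"
    using assms(1) unfolding has_laplacian_def by blast
  obtain r where r: "0 < r" "ball x r \<subseteq> U"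
    using assms(2,3) openE by blast
  have "0 \<le> D b" if b: "b \<in> Basis" for b
  proof -
    obtain g' where g': "\<And>t. ((\<lambda>t. f (x + t *\<^sub>R b)) has_field_derivative g' t) (at t)"
      "(g' has_field_derivative D b) (at 0)"
      using D(1)[OF b] unfolding has_second_along_def by blast
    have "f (x + 0 *\<^sub>R b) \<le> f (x + t *\<^sub>R b)" if "\<bar>t\<bar> < r" for t
      using that b r(2) assms(4) by (auto simp: subset_iff dist_norm)
    then show ?thesis
      using second_deriv_nonneg_at_min[OF g' r(1)] by blast
  qed
  then show ?thesis
    unfolding D(2) by (rule sum_nonneg)
qed

text \<open>
  A negative minimum over \<open>K\<close> would be attained inside \<open>U\<close>, where it forces a nonnegative
  Laplacian.  The strict sign of the Laplacian is required only where \<open>f\<close> is negative; this is what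
  makes the principle usable with a zeroth-order term in \<open>weak_Harnack\<close>.
\<close>

lemma minimum_principle:
  fixes f :: "'a::euclidean_space \<Rightarrow> real"
  assumes "compact K" "continuous_on K f" "open U" "U \<subseteq> K"
    and boundary: "\<And>x. x \<in> K \<Longrightarrow> x \<notin> U \<Longrightarrow> 0 \<le> f x"
    and interior: "\<And>x. x \<in> U \<Longrightarrow> f x < 0 \<Longrightarrow> \<exists>L<0. has_laplacian f L x"
    and "y \<in> K"
  shows "0 \<le> f y"
proof -
  obtain x where x: "x \<in> K" "\<And>z. z \<in> K \<Longrightarrow> f x \<le> f z"
    using continuous_attains_inf[OF assms(1) _ assms(2)] \<open>y \<in> K\<close> by blast
  have "0 \<le> f x"
  proof (rule ccontr)
    assume neg: "\<not> 0 \<le> f x"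
    then have "x \<in> U"
      using boundary x(1) by blast
    moreover obtain L where "L < 0" "has_laplacian f L x"
      using interior[OF \<open>x \<in> U\<close>] neg by auto
    ultimately show False
      using has_laplacian_nonneg_at_min[OF _ assms(3), of f L x] x(2) assms(4) by fastforce
  qed
  then show ?thesis
    using x(2)[OF \<open>y \<in> K\<close>] by simp
qed

section \<open>A Lipschitz bound\<close>

text \<open>
  Half the difference of \<open>v\<close> and its reflection in the hyperplane through \<open>p\<close> orthogonal to \<open>e\<close> vanishes
  on that hyperplane, is at most \<open>C\<close> in absolute value, and has Laplacian at most \<open>B\<close> in absolute value.
  On the unit half-ball around \<open>p\<close> it therefore lies below the
  barrier \<open>C |z|\<^sup>2 + M z\<^sub>e - M z\<^sub>e\<^sup>2\<close>, which is at least \<open>C\<close> on the sphere, nonnegative on the flat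
  part, and has Laplacian less than \<open>- B\<close> by the choice of \<open>M\<close>.  On the
  axis the barrier grows linearly.
\<close>

lemma odd_difference_bound_of_bounded_laplacian:
  fixes v :: "'a::euclidean_space \<Rightarrow> real" and B C t :: real
  assumes cont: "continuous_on UNIV v" and lap: "\<And>x. has_laplacian v (Lv x) x"
    and B: "\<And>x. \<bar>Lv x\<bar> \<le> B" and C: "\<And>x. \<bar>v x\<bar> \<le> C"
    and e: "e \<in> Basis" and t: "0 \<le> t" "t \<le> 1"
  shows "v (p + t *\<^sub>R e) - v (p - t *\<^sub>R e) \<le> 2 * (C + (DIM('a) * C + B / 2 + 1)) * t"
proof -
  define M where "M = DIM('a) * C + B / 2 + 1"
  have "0 \<le> C" "0 \<le> B"
    using C[of 0] B[of 0] by auto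
  then have M: "0 \<le> M"
    by (simp add: M_def)
  let ?r = "\<lambda>z. z - (2 * (z \<bullet> e)) *\<^sub>R e"
  define \<phi> where "\<phi> z = (C * (norm z)\<^sup>2 + M * (e \<bullet> z) - M * (e \<bullet> z)\<^sup>2) -
      ((1/2) * v (p + z) - (1/2) * v (p + ?r z))" for z
  let ?K = "cball 0 1 \<inter> {z. 0 \<le> e \<bullet> z}" and ?U = "ball 0 1 \<inter> {z. 0 < e \<bullet> z}"
  have "0 \<le> \<phi> (t *\<^sub>R e)"
  proof (rule minimum_principle[of ?K \<phi> ?U])
    show "compact ?K"
      by (intro compact_Int_closed compact_cball closed_halfspace_ge)
    show "open ?U"
      by (intro open_Int open_ball open_halfspace_gt)
    show "continuous_on ?K \<phi>"
      unfolding \<phi>_def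
      by (intro continuous_intros continuous_on_compose2[OF cont]) auto
    show "?U \<subseteq> ?K"
      by auto
    show "t *\<^sub>R e \<in> ?K"
      using e t by (simp add: inner_same_Basis)
  next
    fix z assume z: "z \<in> ?K" "z \<notin> ?U"
    show "0 \<le> \<phi> z"
    proof (cases "e \<bullet> z = 0")
      case True
      then show ?thesis
        using \<open>0 \<le> C\<close> by (simp add: \<phi>_def inner_commute)
    next
      case False
      then have 1: "norm z = 1" "0 \<le> e \<bullet> z"
        using z by auto
      then have "e \<bullet> z \<le> 1"
        using e norm_cauchy_schwarz[of e z] by simp
      then have "M * (e \<bullet> z)\<^sup>2 \<le> M * (e \<bullet> z)"
        using 1 M by (intro mult_left_mono) (auto simp: power2_eq_square mult_left_le)
      then show ?thesis
        using C[of "p + z"] C[of "p + ?r z"] 1 by (simp add: \<phi>_def)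
    qed
  next
    fix z
    let ?L = "(C * (2 * DIM('a)) + M * 0 - M * 2) - ((1/2) * Lv (p + z) - (1/2) * Lv (p + ?r z))"
    have "has_laplacian \<phi> ?L z"
      unfolding \<phi>_def
      by (intro has_laplacian_diff has_laplacian_add has_laplacian_cmult has_laplacian_norm_square
          has_laplacian_inner_left has_laplacian_coordinate_square e has_laplacian_translate lap
          has_laplacian_reflect[where f = "\<lambda>z. v (p + z)"])
    moreover have "?L < 0"
      using B[of "p + z"] B[of "p + ?r z"] by (simp add: M_def algebra_simps)
    ultimately show "\<exists>L<0. has_laplacian \<phi> L z"
      by blast
  qed
  moreover have "?r (t *\<^sub>R e) = - (t *\<^sub>R e)"
    using e by (simp add: inner_same_Basis flip: scaleR_diff_left scaleR_minus_left)
  moreover have "C * t\<^sup>2 \<le> C * t" "0 \<le> M * t\<^sup>2"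
    using \<open>0 \<le> C\<close> t M by (auto intro!: mult_left_mono simp: power2_eq_square mult_left_le)
  ultimately show ?thesis
    using e unfolding \<phi>_def M_def[symmetric]
    by (simp only: norm_scaleR inner_scaleR_right) (simp add: inner_same_Basis algebra_simps)
qed

lemma Lipschitz_from_coordinate_directions:
  fixes v :: "'a::euclidean_space \<Rightarrow> real" and Q :: real
  assumes v: "\<And>x b t. b \<in> Basis \<Longrightarrow> v (x + t *\<^sub>R b) - v x \<le> Q * \<bar>t\<bar>" and "0 \<le> Q"
  shows "\<bar>v y - v x\<bar> \<le> DIM('a) * Q * norm (y - x)"
proof -
  have *: "v y - v x \<le> DIM('a) * Q * norm (y - x)" for x y
  proof -
    have "v (x + (\<Sum>b\<in>S. ((y - x) \<bullet> b) *\<^sub>R b)) - v x \<le> card S * Q * norm (y - x)"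
      if "finite S" "S \<subseteq> Basis" for S
      using that
    proof (induction S)
      case (insert b S)
      let ?s = "x + (\<Sum>b\<in>S. ((y - x) \<bullet> b) *\<^sub>R b)"
      have "v (?s + ((y - x) \<bullet> b) *\<^sub>R b) - v ?s \<le> Q * \<bar>(y - x) \<bullet> b\<bar>"
        using insert.prems by (intro v) auto
      also have "\<dots> \<le> Q * norm (y - x)"
        using insert.prems \<open>0 \<le> Q\<close> by (intro mult_left_mono Basis_le_norm) auto
      finally show ?case
        using insert by (simp add: algebra_simps)
    qed simp
    from this[OF finite_Basis order_refl] show ?thesis
      by (simp add: euclidean_representation)
  qed
  show ?thesis
    using *[of x y] *[of y x] by (simp add: norm_minus_commute)
qed

text \<open>
  For steps of length at most \<open>2\<close> along a coordinate axis the previous bound is applied at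
  the midpoint, to \<open>v\<close> and to \<open>- v\<close>; for longer steps \<open>\<bar>v\<bar> \<le> C\<close> suffices.
\<close>

lemma bounded_laplacian_imp_Lipschitz:
  fixes v :: "'a::euclidean_space \<Rightarrow> real" and B C :: real
  assumes cont: "continuous_on UNIV v" and lap: "\<And>x. has_laplacian v (Lv x) x"
    and B: "\<And>x. \<bar>Lv x\<bar> \<le> B" and C: "\<And>x. \<bar>v x\<bar> \<le> C"
  shows "\<exists>\<Lambda>\<ge>0. \<forall>x y. \<bar>v y - v x\<bar> \<le> \<Lambda> * norm (y - x)"
proof -
  define Q where "Q = C + (DIM('a) * C + B / 2 + 1)"
  have "0 \<le> C" "0 \<le> B"
    using C[of 0] B[of 0] by auto
  then have Q: "0 \<le> Q" "C \<le> Q"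
    by (auto simp: Q_def)
  have pos: "v (x + t *\<^sub>R b) - v x \<le> Q * t" "v x - v (x + t *\<^sub>R b) \<le> Q * t"
    if b: "b \<in> Basis" and t: "0 \<le> t" for x b t
  proof -
    have "v (x + t *\<^sub>R b) - v x \<le> Q * t \<and> v x - v (x + t *\<^sub>R b) \<le> Q * t"
    proof (cases "t \<le> 2")
      case True
      let ?p = "x + (t / 2) *\<^sub>R b"
      have ends: "?p + (t / 2) *\<^sub>R b = x + t *\<^sub>R b" "?p - (t / 2) *\<^sub>R b = x"
        by (simp_all add: add.assoc flip: scaleR_add_left)
      note odd_difference_bound_of_bounded_laplacian[OF cont lap B C b, of "t / 2" ?p]
      moreover have "has_laplacian (\<lambda>x. - v x) (- Lv x) x" for x
        using has_laplacian_cmult[OF lap, of "-1"] by simp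
      then have "- v (?p + (t / 2) *\<^sub>R b) - - v (?p - (t / 2) *\<^sub>R b)
          \<le> 2 * (C + (DIM('a) * C + B / 2 + 1)) * (t / 2)"
        using cont B C t True
        by (intro odd_difference_bound_of_bounded_laplacian[where v = "\<lambda>x. - v x"] b)
           (auto intro: continuous_on_minus)
      ultimately show ?thesis
        using True t unfolding ends Q_def[symmetric] by simp
    next
      case False
      then have "2 * C \<le> Q * t"
        using Q \<open>0 \<le> C\<close> mult_mono[of C Q 2 t] by simp
      then show ?thesis
        using C[of x] C[of "x + t *\<^sub>R b"] by (simp add: abs_le_iff)
    qed
    then show "v (x + t *\<^sub>R b) - v x \<le> Q * t" "v x - v (x + t *\<^sub>R b) \<le> Q * t"
      by auto
  qed
  have "v (x + t *\<^sub>R b) - v x \<le> Q * \<bar>t\<bar>" if "b \<in> Basis" for x b t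
    using pos(1)[OF that, of t x] pos(2)[OF that, of "- t" "x + t *\<^sub>R b"] by (cases "0 \<le> t") auto
  then show ?thesis
    using Lipschitz_from_coordinate_directions[of v Q] Q(1)
    by (intro exI[of _ "DIM('a) * Q"]) auto
qed

section \<open>A weak Harnack inequality\<close>

text \<open>
  A nonnegative supersolution of \<open>\<Delta> w = l w\<close> that is at least \<open>\<delta>\<close> on a small ball stays above
  the barrier \<open>\<delta> (exp (- a |z|\<^sup>2) - exp (- a (R + 1)\<^sup>2))\<close> on the surrounding annulus
  \<open>r \<le> |z| \<le> R + 1\<close>: the barrier is at most \<open>\<delta>\<close> on the inner sphere, zero on the outer one, and for
  large \<open>a\<close> its Laplacian exceeds \<open>l\<close> times the Gaussian.  The outer radius is \<open>R + 1\<close> so that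
  the barrier is still positive at distance \<open>R\<close>.  The quantifier over \<open>w\<close> stands inside, since
  the point is that \<open>\<epsilon>\<close> is the same for all \<open>w\<close> and all centres \<open>y\<close>.
\<close>

lemma weak_Harnack:
  fixes \<delta> l r R :: real
  assumes "0 < \<delta>" "0 \<le> l" "0 < r" "r \<le> R"
  shows "\<exists>\<epsilon>>0. \<forall>(w::'a::euclidean_space \<Rightarrow> real) Lw y.
     continuous_on UNIV w \<longrightarrow> (\<forall>x. 0 \<le> w x) \<longrightarrow>
     (\<forall>x. has_laplacian w (Lw x) x \<and> Lw x \<le> l * w x) \<longrightarrow>
     (\<forall>x\<in>cball y r. \<delta> \<le> w x) \<longrightarrow> (\<forall>x\<in>cball y R. \<epsilon> \<le> w x)"
proof -
  let ?n = "real DIM('a)"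
  \<comment> \<open>This choice gives \<open>4 a\<^sup>2 s\<^sup>2 - 2 a n > l\<close> for \<open>s \<ge> r\<close>, which makes the Gaussian a strict
    subsolution off the ball of radius \<open>r\<close>.\<close>
  define a where "a = 1 + (?n + l) / r\<^sup>2"
  define G where "G s = exp (- a * s\<^sup>2)" for s
  have n: "1 \<le> ?n"
    using DIM_positive[where 'a='a] by linarith
  have a: "1 \<le> a" "?n + l \<le> a * r\<^sup>2"
    using assms n by (auto simp: a_def field_simps)
  have G_mono: "G s' \<le> G s" if "0 \<le> s" "s \<le> s'" for s s'
    using that a by (simp add: G_def mult_left_mono power_mono)
  have G_le_1: "G s \<le> 1" for s
    using a by (simp add: G_def)
  have "R\<^sup>2 < (R + 1)\<^sup>2"
    using assms by (intro power_strict_mono) auto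
  then have \<epsilon>: "0 < \<delta> * (G R - G (R + 1))"
    using a assms by (simp add: G_def)
  have main: "\<delta> * (G R - G (R + 1)) \<le> w x"
    if cont: "continuous_on UNIV w" and nonneg: "\<And>x. 0 \<le> w x"
      and lap: "\<And>x. has_laplacian w (Lw x) x" "\<And>x. Lw x \<le> l * w x"
      and lower: "\<And>x. x \<in> cball y r \<Longrightarrow> \<delta> \<le> w x" and x: "x \<in> cball y R"
    for w Lw and x y :: 'a
  proof (cases "x \<in> cball y r")
    case True
    have "0 \<le> G (R + 1)"
      by (simp add: G_def)
    then have "G R - G (R + 1) \<le> 1"
      using G_le_1[of R] by linarith
    then have "\<delta> * (G R - G (R + 1)) \<le> \<delta> * 1"
      using assms by (intro mult_left_mono) auto
    then show ?thesis
      using lower[OF True] by simp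
  next
    case False
    define \<phi> where "\<phi> z = w (y + z) - (\<delta> * G (norm z) - \<delta> * G (R + 1))" for z
    let ?K = "cball (0::'a) (R + 1) - ball 0 r" and ?U = "ball (0::'a) (R + 1) - cball 0 r"
    have "0 \<le> \<phi> (x - y)"
    proof (rule minimum_principle[of ?K \<phi> ?U])
      show "compact ?K"
        using compact_cball open_ball by (rule compact_diff)
      show "open ?U"
        by (intro open_Diff open_ball closed_cball)
      show "continuous_on ?K \<phi>"
        unfolding \<phi>_def G_def
        by (intro continuous_intros continuous_on_compose2[OF cont]) auto
      show "?U \<subseteq> ?K"
        by auto
      show "x - y \<in> ?K"
        using x False by (auto simp: dist_norm norm_minus_commute)
    next
      fix z assume z: "z \<in> ?K" "z \<notin> ?U"
      then consider "norm z = r" | "norm z = R + 1"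
        by force
      then show "0 \<le> \<phi> z"
      proof cases
        case 1
        then have "\<delta> \<le> w (y + z)"
          by (intro lower) (simp add: dist_norm)
        moreover have "\<delta> * G (norm z) \<le> \<delta> * 1" "0 \<le> \<delta> * G (R + 1)"
          using assms G_le_1 by (auto intro!: mult_left_mono simp: G_def)
        ultimately show ?thesis
          by (simp add: \<phi>_def)
      next
        case 2
        then show ?thesis
          using nonneg by (simp add: \<phi>_def)
      qed
    next
      fix z assume z: "z \<in> ?U" "\<phi> z < 0"
      let ?g = "G (norm z)"
      let ?q = "4 * a\<^sup>2 * (norm z)\<^sup>2 - 2 * a * ?n"
      let ?L = "Lw (y + z) - (\<delta> * (?g * ?q) - 0)"
      have "has_laplacian \<phi> ?L z"
        unfolding \<phi>_def G_def
        by (rule has_laplacian_diff[OF has_laplacian_translate[where f = w, OF lap(1)]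
              has_laplacian_diff[OF has_laplacian_cmult[OF has_laplacian_gaussian] has_laplacian_const]])
      moreover have "?L < 0"
      proof -
        have "r\<^sup>2 \<le> (norm z)\<^sup>2"
          using z assms by (intro power_mono) auto
        then have "?n + l \<le> a * (norm z)\<^sup>2"
          using a mult_left_mono[of "r\<^sup>2" "(norm z)\<^sup>2" a] by linarith
        then have "4 * a * (?n + l) \<le> 4 * a * (a * (norm z)\<^sup>2)"
          using a by (intro mult_left_mono) auto
        moreover have "l \<le> a * l" "0 < a * ?n"
          using a n assms mult_right_mono[of 1 a] by auto
        moreover have "4 * a * (?n + l) = 4 * (a * ?n) + 4 * (a * l)"
          "?q = 4 * a * (a * (norm z)\<^sup>2) - 2 * (a * ?n)"
          by (simp_all add: power2_eq_square algebra_simps)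
        ultimately have "l < ?q"
          using assms by linarith
        moreover have "0 < \<delta> * ?g"
          using assms by (simp add: G_def)
        ultimately have "\<delta> * ?g * l < \<delta> * ?g * ?q"
          by (rule mult_strict_left_mono)
        moreover have "w (y + z) \<le> \<delta> * ?g"
          using z(2) mult_pos_pos[OF assms(1), of "G (R + 1)"] unfolding \<phi>_def
          by (simp add: G_def[of "R + 1"])
        then have "Lw (y + z) \<le> l * (\<delta> * ?g)"
          using lap(2)[of "y + z"] mult_left_mono[OF _ assms(2), of "w (y + z)" "\<delta> * ?g"] by linarith
        ultimately show ?thesis
          by (simp add: mult.assoc mult.commute[of l])
      qed
      ultimately show "\<exists>L<0. has_laplacian \<phi> L z"
        by blast
    qed
    moreover have "\<delta> * G R \<le> \<delta> * G (norm (x - y))"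
      using x assms by (intro mult_left_mono G_mono) (auto simp: dist_norm norm_minus_commute)
    ultimately show ?thesis
      by (simp add: \<phi>_def algebra_simps)
  qed
  show ?thesis
    using \<epsilon> main by (intro exI[of _ "\<delta> * (G R - G (R + 1))"]) blast
qed

section \<open>Sliding\<close>

text \<open>
  This replaces the compactness and strong maximum principle of the usual sliding method.  Among
  the \<open>N\<close> consecutive increments of \<open>u\<close> along \<open>k\<close> starting at \<open>x\<close>, one exceeds \<open>1 / N\<close>, because
  they add up to more than \<open>1\<close>; the Lipschitz bound spreads half of this to a ball of radius
  \<open>r\<close>, and the weak Harnack inequality brings it back to \<open>x\<close>.
\<close>

lemma strict_increase_of_ordered_translate:
  fixes u :: "'a::euclidean_space \<Rightarrow> real" and f :: "real \<Rightarrow> real"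
  assumes cont: "continuous_on UNIV u" and lap: "\<And>x. has_laplacian u (- f (u x)) x"
    and f: "\<And>s t. \<bar>f s - f t\<bar> \<le> l * \<bar>s - t\<bar>" "0 \<le> l"
    and C: "\<And>x. \<bar>u x - \<alpha> \<bullet> x\<bar> \<le> C"
    and \<Lambda>: "\<And>x y. \<bar>u y - u x\<bar> \<le> \<Lambda> * norm (y - x)" "0 \<le> \<Lambda>"
    and k: "0 < \<alpha> \<bullet> k" and le: "\<And>x. u x \<le> u (k + x)"
  shows "\<exists>\<epsilon>>0. \<forall>x. u x + \<epsilon> \<le> u (k + x)"
proof -
  have "0 \<le> C"
    using C[of 0] by auto
  obtain N :: nat where N: "2 * C + 1 < N * (\<alpha> \<bullet> k)"
    using reals_Archimedean3[OF k] by blast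
  then have "0 < N"
    using \<open>0 \<le> C\<close> by (cases N) auto
  define w where "w x = u (k + x) - u x" for x
  define r where "r = 1 / (4 * N * (\<Lambda> + 1))"
  define R where "R = r + N * norm k"
  have r: "0 < r"
    using \<open>0 < N\<close> \<Lambda> by (simp add: r_def)
  have w_cont: "continuous_on UNIV w"
    unfolding w_def by (intro continuous_intros continuous_on_compose2[OF cont]) auto
  have w_nonneg: "0 \<le> w x" for x
    using le[of x] by (simp add: w_def)
  have w_lap: "has_laplacian w (- f (u (k + x)) - - f (u x)) x" for x
    unfolding w_def by (intro has_laplacian_diff has_laplacian_translate lap)
  have w_super: "- f (u (k + x)) - - f (u x) \<le> l * w x" for x
    using f(1)[of "u (k + x)" "u x"] w_nonneg[of x] by (simp add: w_def)
  have "0 < 1 / (2 * real N)" "r \<le> R"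
    using \<open>0 < N\<close> by (auto simp: R_def)
  from weak_Harnack[where 'a='a, OF this(1) f(2) r this(2)]
  obtain \<epsilon> where \<epsilon>: "0 < \<epsilon>" and "\<forall>(w::'a \<Rightarrow> real) Lw y.
     continuous_on UNIV w \<longrightarrow> (\<forall>x. 0 \<le> w x) \<longrightarrow>
     (\<forall>x. has_laplacian w (Lw x) x \<and> Lw x \<le> l * w x) \<longrightarrow>
     (\<forall>x\<in>cball y r. 1 / (2 * real N) \<le> w x) \<longrightarrow> (\<forall>x\<in>cball y R. \<epsilon> \<le> w x)"
    by blast
  from this(2)[rule_format, OF w_cont w_nonneg conjI[OF w_lap w_super]]
  have Harnack: "\<epsilon> \<le> w x"
    if "\<And>z. z \<in> cball y r \<Longrightarrow> 1 / (2 * real N) \<le> w z" "x \<in> cball y R" for x y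
    using that by blast
  have "\<epsilon> \<le> w x" for x
  proof -
    have "(\<Sum>j<N. w (x + j *\<^sub>R k)) = (\<Sum>j<N. u (x + Suc j *\<^sub>R k) - u (x + j *\<^sub>R k))"
      by (simp add: w_def algebra_simps)
    also have "\<dots> = u (x + N *\<^sub>R k) - u x"
      by (subst sum_lessThan_telescope) simp
    also have "\<dots> > 1"
      using N C[of x] C[of "x + N *\<^sub>R k"] by (simp add: inner_add_right abs_le_iff)
    finally have sum: "1 < (\<Sum>j<N. w (x + j *\<^sub>R k))" .
    obtain j where j: "j < N" "1 / N < w (x + j *\<^sub>R k)"
    proof (rule ccontr)
      assume "\<not> thesis"
      then have "w (x + j *\<^sub>R k) \<le> 1 / N" if "j < N" for j
        using that \<open>\<And>j. j < N \<Longrightarrow> 1 / N < w (x + j *\<^sub>R k) \<Longrightarrow> thesis\<close> by force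
      then show False
        using sum_bounded_above[of "{..<N}" "\<lambda>j. w (x + j *\<^sub>R k)" "1 / N"] sum \<open>0 < N\<close> by simp
    qed
    let ?y = "x + j *\<^sub>R k"
    show ?thesis
    proof (rule Harnack[of ?y])
      fix z assume "z \<in> cball ?y r"
      then have z: "norm (z - ?y) \<le> r"
        by (simp add: dist_norm norm_minus_commute)
      have "w ?y - w z \<le> 2 * (\<Lambda> * norm (z - ?y))"
        using \<Lambda>(1)[of z ?y] \<Lambda>(1)[of "k + z" "k + ?y"]
        by (simp add: w_def abs_le_iff norm_minus_commute)
      also have "\<dots> \<le> 2 * ((\<Lambda> + 1) * r)"
        using z \<Lambda>(2) by (intro mult_left_mono mult_mono) auto
      also have "\<dots> = 1 / (2 * real N)"
        using \<Lambda>(2) \<open>0 < N\<close> by (simp add: r_def divide_simps)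
      finally show "1 / (2 * real N) \<le> w z"
        using j(2) by (simp add: field_simps)
    next
      have "j * norm k \<le> N * norm k"
        using j by (intro mult_right_mono) auto
      then show "x \<in> cball ?y R"
        using r by (simp add: R_def dist_norm)
    qed
  qed
  then show ?thesis
    using \<epsilon> by (intro exI[of _ \<epsilon>]) (auto simp: w_def algebra_simps)
qed

text \<open>
  The set \<open>S\<close> of thresholds beyond which all translates along \<open>h\<close> are ordered is nonempty since
  \<open>u\<close> stays close to \<open>x \<mapsto> \<alpha> \<bullet> x\<close>.  At a positive infimum the increments would be uniformly
  positive by the previous lemma, so that, \<open>u\<close> being Lipschitz, a slightly smaller
  threshold would also belong to \<open>S\<close>.
\<close>

lemma monotone_in_increasing_directions:
  fixes u :: "'a::euclidean_space \<Rightarrow> real" and f :: "real \<Rightarrow> real"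
  assumes cont: "continuous_on UNIV u" and lap: "\<And>x. has_laplacian u (- f (u x)) x"
    and f: "\<And>s t. \<bar>f s - f t\<bar> \<le> l * \<bar>s - t\<bar>" "0 \<le> l"
    and C: "\<And>x. \<bar>u x - \<alpha> \<bullet> x\<bar> \<le> C"
    and \<Lambda>: "\<And>x y. \<bar>u y - u x\<bar> \<le> \<Lambda> * norm (y - x)" "0 \<le> \<Lambda>"
    and h: "0 < \<alpha> \<bullet> h"
  shows "u x \<le> u (h + x)"
proof -
  define S where "S = {t. 0 \<le> t \<and> (\<forall>s\<ge>t. \<forall>x. u x \<le> u (s *\<^sub>R h + x))}"
  have "0 \<le> C"
    using C[of 0] by auto
  have large: "2 * C / (\<alpha> \<bullet> h) \<in> S"
  proof -
    have "u x \<le> u (s *\<^sub>R h + x)" if "2 * C / (\<alpha> \<bullet> h) \<le> s" for s x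
      using that h C[of x] C[of "s *\<^sub>R h + x"] by (simp add: inner_add_right abs_le_iff field_simps)
    then show ?thesis
      using \<open>0 \<le> C\<close> h by (simp add: S_def)
  qed
  have bdd: "bdd_below S"
    by (auto simp: S_def intro: bdd_belowI[of _ 0])
  define t where "t = Inf S"
  have "0 \<le> t"
    unfolding t_def using large by (intro cInf_greatest) (auto simp: S_def)
  have above: "u x \<le> u (s *\<^sub>R h + x)" if "t < s" for s x
  proof -
    obtain s' where "s' \<in> S" "s' < s"
      using \<open>t < s\<close> large cInf_lessD[of S s] unfolding t_def by auto
    then show ?thesis
      by (auto simp: S_def)
  qed
  have at: "u x \<le> u (t *\<^sub>R h + x)" for x
  proof (rule tendsto_lowerbound)
    show "((\<lambda>s. u (s *\<^sub>R h + x)) \<longlongrightarrow> u (t *\<^sub>R h + x)) (at_right t)"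
      using cont by (intro continuous_on_tendsto_compose[of UNIV u] tendsto_intros) auto
    show "\<forall>\<^sub>F s in at_right t. u x \<le> u (s *\<^sub>R h + x)"
      using above by (auto simp: eventually_at_right_less intro: eventually_mono[OF eventually_at_right_less])
  qed simp
  have "t = 0"
  proof (rule ccontr)
    assume "t \<noteq> 0"
    then have "0 < t"
      using \<open>0 \<le> t\<close> by simp
    then have "0 < \<alpha> \<bullet> (t *\<^sub>R h)"
      using h by simp
    then obtain \<epsilon> where \<epsilon>: "0 < \<epsilon>" "\<And>x. u x + \<epsilon> \<le> u (t *\<^sub>R h + x)"
      using strict_increase_of_ordered_translate[OF cont lap f C \<Lambda>, of "t *\<^sub>R h"] at by blast
    define d where "d = min t (\<epsilon> / (\<Lambda> * norm h + 1))"
    have pos: "0 < \<Lambda> * norm h + 1"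
      using \<Lambda>(2) by (simp add: add_nonneg_pos)
    have d: "0 < d" "d \<le> t"
      using \<epsilon>(1) \<open>0 < t\<close> pos by (auto simp: d_def)
    have "d * (\<Lambda> * norm h + 1) \<le> \<epsilon>"
      using pos by (simp add: d_def flip: pos_le_divide_eq)
    then have d\<epsilon>: "d * (\<Lambda> * norm h) \<le> \<epsilon>"
      using d by (simp add: algebra_simps)
    have "u x \<le> u (s *\<^sub>R h + x)" if s: "t - d \<le> s" for s x
    proof (cases "s \<le> t")
      case True
      have "u (t *\<^sub>R h + x) - u (s *\<^sub>R h + x) \<le> \<Lambda> * norm (t *\<^sub>R h + x - (s *\<^sub>R h + x))"
        using \<Lambda>(1) abs_le_D1 by blast
      also have "\<dots> = (t - s) * (\<Lambda> * norm h)"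
        using True by (simp flip: scaleR_diff_left)
      also have "\<dots> \<le> d * (\<Lambda> * norm h)"
        using s \<Lambda>(2) by (intro mult_right_mono) auto
      finally show ?thesis
        using d\<epsilon> \<epsilon>(2)[of x] by simp
    next
      case False
      then show ?thesis
        using above by simp
    qed
    then have "t - d \<in> S"
      using d by (auto simp: S_def)
    then have "t \<le> t - d"
      unfolding t_def using bdd by (rule cInf_lower)
    then show False
      using d by simp
  qed
  then show ?thesis
    using above[of 1] by simp
qed

section \<open>Periodic functions\<close>

lemma periodic_continuous_imp_bounded:
  fixes g :: "real \<Rightarrow> real"
  assumes "periodic_fun_simple g T" "0 < T" "continuous_on UNIV g"
  shows "\<exists>B. \<forall>x. \<bar>g x\<bar> \<le> B"
proof -
  interpret periodic_fun_simple g T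
    by fact
  have "compact (g ` {0..T})"
    using assms(3) by (intro compact_continuous_image) (auto intro: continuous_on_subset)
  then obtain B where B: "\<And>x. 0 \<le> x \<Longrightarrow> x \<le> T \<Longrightarrow> \<bar>g x\<bar> \<le> B"
    using compact_imp_bounded[THEN bounded_iff[THEN iffD1]] by force
  have "\<bar>g x\<bar> \<le> B" for x
  proof -
    have "0 \<le> x - of_int \<lfloor>x / T\<rfloor> * T" "x - of_int \<lfloor>x / T\<rfloor> * T \<le> T"
      using floor_divide_lower[OF assms(2), of x] floor_divide_upper[OF assms(2), of x]
      by (auto simp: algebra_simps)
    then show ?thesis
      using B minus_of_int[of x "\<lfloor>x / T\<rfloor>"] by metis
  qed
  then show ?thesis
    by blast
qed

lemma periodic_deriv:
  fixes g :: "real \<Rightarrow> real"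
  assumes "periodic_fun_simple g T"
  shows "periodic_fun_simple (deriv g) T"
proof
  interpret periodic_fun_simple g T
    by fact
  show "deriv g (x + T) = deriv g x" for x
    using plus_period by (simp add: deriv_def DERIV_shift)
qed

lemma partial_1_eq_deriv: "partial 1 f = deriv f"
  using DERIV_shift[of f _ 0] by (auto simp: partial_def deriv_def add.commute)

section \<open>One-dimensional symmetry\<close>

theorem theorem1p1:
  fixes F :: "real \<Rightarrow> real" and u :: "real ^ 'n \<Rightarrow> real"
    and \<alpha> :: "real ^ 'n" and C :: real
  assumes "smooth F"
    and "\<exists>T>0. periodic_fun_simple F T"
    and "Ck 2 u"
    and "\<And>x. - laplacian u x = deriv F (u x)"
    and "\<alpha> \<noteq> 0"
    and "C > 0"
    and "\<And>x. \<bar>u x - \<alpha> \<bullet> x\<bar> \<le> C"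
  shows "\<exists>v :: real \<Rightarrow> real. Ck 2 v \<and> (\<forall>x. u x = v (\<alpha> \<bullet> x))"
proof -
  obtain T where T: "0 < T" "periodic_fun_simple F T"
    using assms(2) by blast
  have "Ck 2 F"
    using assms(1) by (simp add: smooth_def)
  note F = Ck_2D[OF this, of 1, simplified partial_1_eq_deriv, simplified]
  obtain B where B: "\<And>x. \<bar>deriv F x\<bar> \<le> B"
    using periodic_continuous_imp_bounded[OF periodic_deriv[OF T(2)] T(1) F(3)] by blast
  obtain l where l: "\<And>x. \<bar>deriv (deriv F) x\<bar> \<le> l"
    using periodic_continuous_imp_bounded[OF periodic_deriv[OF periodic_deriv[OF T(2)]] T(1) F(5)]
    by blast
  have "(deriv F has_field_derivative deriv (deriv F) x) (at x)" for x
    using has_field_derivative_partial[of "deriv F" 1 0 x] F(4)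
    by (simp add: partial_1_eq_deriv)
  then have f: "\<bar>deriv F s - deriv F t\<bar> \<le> l * \<bar>s - t\<bar>" for s t
    using field_differentiable_bound[of UNIV "deriv F" "deriv (deriv F)" l] l
    by simp
  have "0 \<le> l"
    using l[of 0] by simp
  have cont: "continuous_on UNIV u"
    using assms(3) by (simp add: numeral_2_eq_2)
  have lap: "has_laplacian u (- deriv F (u x)) x" for x
    using has_laplacian_laplacian[OF assms(3), of x] assms(4)[of x] by (metis minus_minus)
  have "\<exists>M\<ge>0. \<forall>x y. \<bar>(u y - \<alpha> \<bullet> y) - (u x - \<alpha> \<bullet> x)\<bar> \<le> M * norm (y - x)"
  proof (rule bounded_laplacian_imp_Lipschitz)
    show "continuous_on UNIV (\<lambda>x. u x - \<alpha> \<bullet> x)"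
      by (intro continuous_intros cont)
    show "has_laplacian (\<lambda>x. u x - \<alpha> \<bullet> x) (- deriv F (u x) - 0) x" for x
      by (intro has_laplacian_diff lap has_laplacian_inner_left)
    show "\<bar>- deriv F (u x) - 0\<bar> \<le> B" for x
      using B by simp
  qed (rule assms(7))
  then obtain M where M: "0 \<le> M"
    "\<And>x y. \<bar>(u y - \<alpha> \<bullet> y) - (u x - \<alpha> \<bullet> x)\<bar> \<le> M * norm (y - x)"
    by blast
  have \<Lambda>: "\<bar>u y - u x\<bar> \<le> (M + norm \<alpha>) * norm (y - x)" for x y
    using M(2)[of y x] Cauchy_Schwarz_ineq2[of \<alpha> "y - x"]
    by (simp add: inner_diff_right algebra_simps)
  have mono: "u x \<le> u (h + x)" if "0 < \<alpha> \<bullet> h" for h x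
    using monotone_in_increasing_directions[OF cont lap f \<open>0 \<le> l\<close> assms(7) \<Lambda> _ that] M(1) by simp
  \<comment> \<open>Tilting \<open>h\<close> slightly towards \<open>\<alpha>\<close> makes the inner product positive.\<close>
  have mono0: "u x \<le> u (h + x)" if "\<alpha> \<bullet> h = 0" for h x
  proof (rule tendsto_lowerbound)
    show "((\<lambda>s. u ((h + s *\<^sub>R \<alpha>) + x)) \<longlongrightarrow> u (h + x)) (at_right 0)"
      using cont by (intro continuous_on_tendsto_compose[of UNIV u] tendsto_eq_intros) auto
    show "\<forall>\<^sub>F s in at_right 0. u x \<le> u ((h + s *\<^sub>R \<alpha>) + x)"
      using that assms(5) by (intro eventually_mono[OF eventually_at_right_less] mono)
        (auto simp: inner_add_right)
  qed simp
  have level: "u x = u y" if "\<alpha> \<bullet> x = \<alpha> \<bullet> y" for x y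
    using mono0[of "y - x" x] mono0[of "x - y" y] that by (simp add: inner_diff_right)
  obtain b where b: "b \<in> Basis" "\<alpha> \<bullet> b \<noteq> 0"
    using assms(5) by (metis euclidean_all_zero_iff)
  define c where "c = 1 / (\<alpha> \<bullet> b)"
  define v where "v s = u ((c * s) *\<^sub>R b)" for s
  have "u x = v (\<alpha> \<bullet> x)" for x
    unfolding v_def using b by (intro level) (simp add: c_def)
  moreover have "Ck 2 v"
  proof -
    have deriv: "((\<lambda>s. g ((c * s) *\<^sub>R b)) has_field_derivative c * partial b g ((c * s) *\<^sub>R b)) (at s)"
      if "\<And>x. has_partial g b x" for g s
      using DERIV_chain'[OF DERIV_cmult_Id[of c] has_field_derivative_partial[of g b 0 "c * s"]] that
      by (simp add: mult.commute[of "partial b g _"])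
    have comp: "continuous_on UNIV (\<lambda>s. g ((c * s) *\<^sub>R b))" if "continuous_on UNIV g" for g :: "real ^ 'n \<Rightarrow> real"
      by (rule continuous_on_compose2[OF that]) (auto intro!: continuous_intros)
    note u = Ck_2D[OF assms(3) b(1)]
    have v1: "(v has_field_derivative c * partial b u ((c * s) *\<^sub>R b)) (at s)" for s
      unfolding v_def by (rule deriv[OF u(2)])
    have v2: "((\<lambda>s. c * partial b u ((c * s) *\<^sub>R b)) has_field_derivative
        c * (c * partial b (partial b u) ((c * s) *\<^sub>R b))) (at s)" for s
      by (rule DERIV_cmult[OF deriv[OF u(4)]])
    have has: "has_partial g 1 s" if "\<And>s. (g has_field_derivative g' s) (at s)" for g g' and s :: real
      unfolding has_partial_def using that[of s] DERIV_shift[of g "g' s" 0 s]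
      by (auto simp: real_differentiable_def add.commute)
    have d1: "partial 1 v = (\<lambda>s. c * partial b u ((c * s) *\<^sub>R b))"
      unfolding partial_1_eq_deriv using v1 DERIV_imp_deriv by blast
    have d2: "partial 1 (\<lambda>s. c * partial b u ((c * s) *\<^sub>R b)) =
        (\<lambda>s. c * (c * partial b (partial b u) ((c * s) *\<^sub>R b)))"
      unfolding partial_1_eq_deriv using v2 DERIV_imp_deriv by blast
    show ?thesis
      using has[OF v1] has[OF v2] comp[OF u(1), folded v_def]
        continuous_on_mult_left[OF comp[OF u(3)], of c]
        continuous_on_mult_left[OF continuous_on_mult_left[OF comp[OF u(5)], of c], of c]
      by (simp add: numeral_2_eq_2 d1 d2)
  qed
  ultimately show ?thesis
    by blast
qed

end
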